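(* Let $\mathcal{X}=\{0,1,\dots,|\mathcal{X}|-1\}$ be a finite alphabet and $\lambda\in[0,1]$. For the modulo-additive state-dependent Z-interference channel over $\mathcal{X}$ with state $S\sim\mathrm{Ber}(\lambda)$ (defined in the context), the sum-capacity (the maximum of $R_1+R_2$ over the capacity region) when the state sequence is known noncausally at encoder 1 only equals $(2-\lambda)\log|\mathcal{X}|$, and this is also the sum-capacity when all nodes (both encoders and both decoders) are provided with the state information. Thus the sum-capacity when all nodes have state information is the same as that when only encoder 1 has state information.
   Context: Channel: all inputs and outputs take values in $\mathcal{X}$; the state $S\in\{0,1\}$ is i.i.d. $\mathrm{Ber}(\lambda)$ (i.e. $\Pr\{S=1\}=\lambda$) over the $n$ channel uses and independent of the messages. In each channel use $$Y_1=X_1,\qquad Y_2=X_2\oplus (S\cdot X_1),$$ where $\oplus$ is addition modulo $|\mathcal{X}|$. Codes: $[1:2^{nR}]$ denotes $\{1,\dots,\lceil 2^{nR}\rceil\}$; logarithms are in base 2. The messages $M_1,M_2$ are independent, uniform on $[1:2^{nR_1}]$ and $[1:2^{nR_2}]$; sender $j$ communicates $M_j$ to receiver $j$. With state information only at encoder 1, a code consists of encoding functions $f_{1,i}:[1:2^{nR_1}]\times\{0,1\}^n\to\mathcal{X}$ (of $(M_1,S^n)$) and $f_{2,i}:[1:2^{nR_2}]\to\mathcal{X}$, $1\le i\le n$, and decoding functions $g_j$ mapping $Y_j^n$ to $[1:2^{nR_j}]$. With state information at all nodes, all of $f_{1,i},f_{2,i},g_1,g_2$ may in addition depend on $S^n$.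 In both cases a pair $(R_1,R_2)$ of nonnegative reals is achievable if for every $\epsilon>0$ there exists, for all sufficiently large $n$, a code for which each decoder $j\in\{1,2\}$ has $\Pr\{\hat M_j\neq M_j\}\le\epsilon$. The capacity region is the closure of the set of achievable rate pairs. *)

theory Defs
  imports "HOL-Probability.Probability"
begin

definition messages :: "nat \<Rightarrow> real \<Rightarrow> nat set" where
  "messages n R = {1..nat \<lceil>2 powr (real n * R)\<rceil>}"

text \<open>
  The alphabet is \<^term>\<open>{..<q}\<close>; a state is a Boolean, with \<^term>\<open>True\<close> standing for \<open>S = 1\<close>.
\<close>

definition channel :: "nat \<Rightarrow> bool \<Rightarrow> nat \<Rightarrow> nat \<Rightarrow> nat \<times> nat" where
  "channel q s x1 x2 = (x1, (x2 + of_bool s * x1) mod q)"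

text \<open>
  Codes are written in their most general form, where every encoder and decoder may read the
  state sequence: \<open>f i m s\<close> is the input at time \<open>i < n\<close> for message \<open>m\<close> and state sequence \<open>s\<close>,
  and \<open>g y s\<close> is the message decoded from the output sequence \<open>y\<close>. Nodes without state information
  are those whose function ignores \<open>s\<close>.
\<close>

type_synonym encoder = "nat \<Rightarrow> nat \<Rightarrow> bool list \<Rightarrow> nat"
type_synonym decoder = "nat list \<Rightarrow> bool list \<Rightarrow> nat"

definition encoder_on :: "nat \<Rightarrow> nat \<Rightarrow> real \<Rightarrow> encoder \<Rightarrow> bool" where
  "encoder_on q n R f \<longleftrightarrow>
     (\<forall>i<n. \<forall>m\<in>messages n R. \<forall>s. length s = n \<longrightarrow> f i m s \<in> {..<q})"

definition decoder_on :: "nat \<Rightarrow> nat \<Rightarrow> real \<Rightarrow> decoder \<Rightarrow> bool" where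
  "decoder_on q n R g \<longleftrightarrow>
     (\<forall>y s. length y = n \<longrightarrow> set y \<subseteq> {..<q} \<longrightarrow> length s = n \<longrightarrow> g y s \<in> messages n R)"

definition outputs ::
  "nat \<Rightarrow> nat \<Rightarrow> encoder \<Rightarrow> encoder \<Rightarrow> nat \<Rightarrow> nat \<Rightarrow> bool list \<Rightarrow> (nat \<times> nat) list" where
  "outputs q n f1 f2 m1 m2 s = map (\<lambda>i. channel q (s ! i) (f1 i m1 s) (f2 i m2 s)) [0..<n]"

definition source_pmf :: "real \<Rightarrow> nat \<Rightarrow> real \<Rightarrow> real \<Rightarrow> (nat \<times> nat \<times> bool list) pmf" where
  "source_pmf lam n R1 R2 =
     pair_pmf (pmf_of_set (messages n R1))
       (pair_pmf (pmf_of_set (messages n R2)) (replicate_pmf n (bernoulli_pmf lam)))"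

definition error1 ::
  "nat \<Rightarrow> real \<Rightarrow> nat \<Rightarrow> real \<Rightarrow> real \<Rightarrow> encoder \<Rightarrow> encoder \<Rightarrow> decoder \<Rightarrow> real" where
  "error1 q lam n R1 R2 f1 f2 g1 =
     measure_pmf.prob (source_pmf lam n R1 R2)
       {(m1, m2, s). g1 (map fst (outputs q n f1 f2 m1 m2 s)) s \<noteq> m1}"

definition error2 ::
  "nat \<Rightarrow> real \<Rightarrow> nat \<Rightarrow> real \<Rightarrow> real \<Rightarrow> encoder \<Rightarrow> encoder \<Rightarrow> decoder \<Rightarrow> real" where
  "error2 q lam n R1 R2 f1 f2 g2 =
     measure_pmf.prob (source_pmf lam n R1 R2)
       {(m1, m2, s). g2 (map snd (outputs q n f1 f2 m1 m2 s)) s \<noteq> m2}"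

definition good_code ::
  "nat \<Rightarrow> real \<Rightarrow> nat \<Rightarrow> real \<Rightarrow> real \<Rightarrow> real \<Rightarrow> encoder \<Rightarrow> encoder \<Rightarrow> decoder \<Rightarrow> decoder \<Rightarrow> bool" where
  "good_code q lam n R1 R2 \<epsilon> f1 f2 g1 g2 \<longleftrightarrow>
     encoder_on q n R1 f1 \<and> encoder_on q n R2 f2 \<and> decoder_on q n R1 g1 \<and> decoder_on q n R2 g2 \<and>
     error1 q lam n R1 R2 f1 f2 g1 \<le> \<epsilon> \<and> error2 q lam n R1 R2 f1 f2 g2 \<le> \<epsilon>"

definition achievable_all :: "nat \<Rightarrow> real \<Rightarrow> real \<Rightarrow> real \<Rightarrow> bool" where
  "achievable_all q lam R1 R2 \<longleftrightarrow> 0 \<le> R1 \<and> 0 \<le> R2 \<and>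
     (\<forall>\<epsilon>>0. \<forall>\<^sub>F n in sequentially. \<exists>f1 f2 g1 g2. good_code q lam n R1 R2 \<epsilon> f1 f2 g1 g2)"

definition achievable_enc1 :: "nat \<Rightarrow> real \<Rightarrow> real \<Rightarrow> real \<Rightarrow> bool" where
  "achievable_enc1 q lam R1 R2 \<longleftrightarrow> 0 \<le> R1 \<and> 0 \<le> R2 \<and>
     (\<forall>\<epsilon>>0. \<forall>\<^sub>F n in sequentially.
        \<exists>(f1 :: nat \<Rightarrow> nat \<Rightarrow> bool list \<Rightarrow> nat) (f2 :: nat \<Rightarrow> nat \<Rightarrow> nat)
         (g1 :: nat list \<Rightarrow> nat) (g2 :: nat list \<Rightarrow> nat).
          good_code q lam n R1 R2 \<epsilon> f1 (\<lambda>i m s. f2 i m) (\<lambda>y s. g1 y) (\<lambda>y s. g2 y))"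

definition capacity_region_all :: "nat \<Rightarrow> real \<Rightarrow> (real \<times> real) set" where
  "capacity_region_all q lam = closure {(R1, R2). achievable_all q lam R1 R2}"

definition capacity_region_enc1 :: "nat \<Rightarrow> real \<Rightarrow> (real \<times> real) set" where
  "capacity_region_enc1 q lam = closure {(R1, R2). achievable_enc1 q lam R1 R2}"

text \<open>Being the sum-capacity is a relation, so that attainment of the maximum is part of it.\<close>

definition is_sum_capacity :: "(real \<times> real) set \<Rightarrow> real \<Rightarrow> bool" where
  "is_sum_capacity C c \<longleftrightarrow>
     (\<exists>(R1, R2)\<in>C. R1 + R2 = c) \<and> (\<forall>(R1, R2)\<in>C. R1 + R2 \<le> c)"

end

(*
  Achievability: encoder 1 sends 0 at every time with S = 1, so receiver 2 sees X_2 undisturbed and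
  user 2 has rate log q. User 1 then faces a memory with stuck-at-0 cells whose positions only the
  encoder knows. Colour all q^n words with the messages at random; the about q^((1 - lam) n) words
  compatible with a typical state sequence carry all colours as long as R1 < (1 - lam) log q, and
  encoder 1 sends a compatible word of the right colour.

  Converse: for a fixed state sequence with k ones, the message pairs decoded correctly inject into
  the pairs (Y_2^n, X_1 at the positions with S = 0), of which there are q^n * q^(n - k). By
  concentration k is about lam n, so any larger sum rate forces an error probability close to 1.
*)

theory Submission
  imports Defs "HOL-Real_Asymp.Real_Asymp"
begin

section \<open>Words, compatible words and message sets\<close>

abbreviation weight :: "bool list \<Rightarrow> nat" where
  "weight s \<equiv> length (filter (\<lambda>b. b) s)"

definition words :: "nat \<Rightarrow> nat \<Rightarrow> nat list set" where
  "words q n = {x. set x \<subseteq> {..<q} \<and> length x = n}"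

text \<open>These are the contents that stuck-at-0 cells at the ones of \<open>s\<close> permit. The
  form with \<open>list_all2\<close> fixes the length as well and splits along \<open>Cons\<close>,
  which suits counting by induction.\<close>

definition words_vanishing_on :: "nat \<Rightarrow> bool list \<Rightarrow> nat list set" where
  "words_vanishing_on q s = {x. list_all2 (\<lambda>b a. a < q \<and> (b \<longrightarrow> a = 0)) s x}"

lemma finite_words: "finite (words q n)"
  unfolding words_def by (intro finite_lists_length_eq) simp

lemma card_words: "card (words q n) = q ^ n"
  unfolding words_def by (simp add: card_lists_length_eq)

lemma words_vanishing_on_iff:
  "x \<in> words_vanishing_on q s \<longleftrightarrow>
     length x = length s \<and> (\<forall>i<length s. x ! i < q \<and> (s ! i \<longrightarrow> x ! i = 0))"
  unfolding words_vanishing_on_def by (auto simp: list_all2_conv_all_nth)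

lemma words_iff: "x \<in> words q n \<longleftrightarrow> length x = n \<and> (\<forall>i<n. x ! i < q)"
  unfolding words_def by (auto simp: set_conv_nth)

lemma words_vanishing_on_subset: "length s = n \<Longrightarrow> words_vanishing_on q s \<subseteq> words q n"
  by (auto simp: words_vanishing_on_iff words_iff)

text \<open>Each position with state 1 contributes the factor 1 and each other position the factor
  \<open>q\<close>.\<close>

lemma card_words_vanishing_on:
  assumes "q \<ge> 1"
  shows "card (words_vanishing_on q s) = q ^ (length s - weight s)"
proof (induction s)
  case Nil
  show ?case by (simp add: words_vanishing_on_def)
next
  case (Cons b s)
  let ?A = "if b then {0} else {..<q}"
  have "words_vanishing_on q (b # s) = (\<lambda>(a, x). a # x) ` (?A \<times> words_vanishing_on q s)"
    using assms unfolding words_vanishing_on_def by (auto simp: list_all2_Cons1 image_iff)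
  moreover have "inj_on (\<lambda>(a, x). a # x) (?A \<times> words_vanishing_on q s)"
    by (auto simp: inj_on_def)
  ultimately have "card (words_vanishing_on q (b # s)) = card ?A * card (words_vanishing_on q s)"
    by (simp add: card_image card_cartesian_product)
  moreover have "Suc (length s) - weight s = Suc (length s - weight s)"
    by (intro Suc_diff_le length_filter_le)
  ultimately show ?case
    using Cons.IH by (cases b) simp_all
qed

lemma powr_log_eq_power:
  assumes "q \<ge> 1"
  shows "real q ^ k = 2 powr (real k * log 2 (real q))"
proof -
  have "2 powr (real k * log 2 (real q)) = (2 powr log 2 (real q)) powr real k"
    by (simp add: powr_powr mult.commute)
  with assms show ?thesis by (simp add: powr_realpow)
qed

lemma finite_messages [simp]: "finite (messages n R)"
  by (simp add: messages_def)

lemma card_messages_ge: "2 powr (real n * R) \<le> real (card (messages n R))"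
  unfolding messages_def by simp

text \<open>For a nonnegative rate the power is at least 1, so rounding up costs at most a factor
  2.\<close>

lemma card_messages_le:
  assumes "0 \<le> R"
  shows "real (card (messages n R)) \<le> 2 * 2 powr (real n * R)"
proof -
  have "1 \<le> 2 powr (real n * R)" using assms by (simp add: ge_one_powr_ge_zero)
  moreover have "real (card (messages n R)) < 2 powr (real n * R) + 1"
    unfolding messages_def by simp linarith
  ultimately show ?thesis by linarith
qed

lemma card_messages_pos: "card (messages n R) > 0"
proof -
  have "0 < real (card (messages n R))"
    by (rule less_le_trans[OF _ card_messages_ge]) simp
  then show ?thesis by simp
qed

lemma messages_nonempty [simp]: "messages n R \<noteq> {}"
  using card_messages_pos[of n R] by auto

lemma messages_zero: "messages n 0 = {1}"
  by (simp add: messages_def)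

text \<open>At rate log q the ceiling rounds nothing, so user 2 has exactly one message per word and
  can use all words as codewords.\<close>

lemma card_messages_log:
  assumes "q \<ge> 1"
  shows "card (messages n (log 2 (real q))) = q ^ n"
proof -
  have "2 powr (real n * log 2 (real q)) = real (q ^ n)"
    using powr_log_eq_power[OF assms, of n] by simp
  then show ?thesis unfolding messages_def by (simp del: of_nat_power)
qed

section \<open>Concentration of the number of ones in the state sequence\<close>

lemma prob_weight_conv_binomial:
  assumes "0 \<le> lam" "lam \<le> 1"
  shows "measure_pmf.prob (replicate_pmf n (bernoulli_pmf lam)) {s. P (weight s)}
     = measure_pmf.prob (binomial_pmf n lam) {k. P k}"
  by (subst binomial_pmf_altdef) (use assms in \<open>auto simp: vimage_def id_def\<close>)

context
  fixes lam \<delta> :: real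
  assumes lam: "0 \<le> lam" "lam \<le> 1" and delta: "\<delta> > 0"
begin

text \<open>The weight is binomial, so Hoeffding's inequality gives an exponential bound.
  Achievability needs this tail: too many ones leave encoder 1 too few compatible words.\<close>

lemma weight_upper_tail:
  "(\<lambda>n. measure_pmf.prob (replicate_pmf n (bernoulli_pmf lam))
      {s. real n * (lam + \<delta>) \<le> real (weight s)}) \<longlonglongrightarrow> 0"
proof (rule tendsto_sandwich[where f = "\<lambda>_. 0" and h = "\<lambda>n. exp (-2 * real n * \<delta>\<^sup>2)"])
  have binomial: "binomial_distribution lam"
    by unfold_locales (use lam in auto)
  show "\<forall>\<^sub>F n in sequentially. measure_pmf.prob (replicate_pmf n (bernoulli_pmf lam))
      {s. real n * (lam + \<delta>) \<le> real (weight s)} \<le> exp (-2 * real n * \<delta>\<^sup>2)"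
    using eventually_gt_at_top[of 0]
  proof eventually_elim
    case (elim n)
    have "{k. real n * (lam + \<delta>) \<le> real k} = {k. lam + \<delta> \<le> real k / real n}"
      using elim by (auto simp: field_simps)
    then show ?case
      using binomial_distribution.prob_ge'[OF binomial elim, of \<delta>] delta
      by (simp add: prob_weight_conv_binomial[OF lam, of _ "\<lambda>k. real n * (lam + \<delta>) \<le> real k"])
  qed
  have "\<delta>\<^sup>2 > 0" using delta by simp
  then show "(\<lambda>n. exp (-2 * real n * \<delta>\<^sup>2)) \<longlonglongrightarrow> 0"
    by real_asymp
qed auto

text \<open>The converse needs this tail: too few ones leave too many possible outputs.\<close>

lemma weight_lower_tail:
  "(\<lambda>n. measure_pmf.prob (replicate_pmf n (bernoulli_pmf lam))
      {s. real (weight s) \<le> real n * (lam - \<delta>)}) \<longlonglongrightarrow> 0"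
proof (rule tendsto_sandwich[where f = "\<lambda>_. 0" and h = "\<lambda>n. exp (-2 * real n * \<delta>\<^sup>2)"])
  have binomial: "binomial_distribution lam"
    by unfold_locales (use lam in auto)
  show "\<forall>\<^sub>F n in sequentially. measure_pmf.prob (replicate_pmf n (bernoulli_pmf lam))
      {s. real (weight s) \<le> real n * (lam - \<delta>)} \<le> exp (-2 * real n * \<delta>\<^sup>2)"
    using eventually_gt_at_top[of 0]
  proof eventually_elim
    case (elim n)
    have "{k. real k \<le> real n * (lam - \<delta>)} = {k. real k / real n \<le> lam - \<delta>}"
      using elim by (auto simp: field_simps)
    then show ?case
      using binomial_distribution.prob_le'[OF binomial elim, of \<delta>] delta
      by (simp add: prob_weight_conv_binomial[OF lam, of _ "\<lambda>k. real k \<le> real n * (lam - \<delta>)"])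
  qed
  have "\<delta>\<^sup>2 > 0" using delta by simp
  then show "(\<lambda>n. exp (-2 * real n * \<delta>\<^sup>2)) \<longlonglongrightarrow> 0"
    by real_asymp
qed auto

end

section \<open>Achievability\<close>

text \<open>In counting form: a uniformly random function misses \<open>b\<close> on all of
  \<open>T\<close> with probability (1 - 1/|B|)^|T|, which is at most exp(-|T|/|B|).\<close>

lemma card_functions_avoiding_value:
  assumes "finite A" "T \<subseteq> A" "finite B" "b \<in> B"
  shows "real (card {g \<in> A \<rightarrow>\<^sub>E B. b \<notin> g ` T})
           \<le> exp (- real (card T) / real (card B)) * real (card (A \<rightarrow>\<^sub>E B))"
proof -
  let ?M = "real (card B)"
  have M: "card B \<ge> 1" using assms(3,4) by (metis Suc_leI card_gt_0_iff empty_iff One_nat_def)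
  \<comment> \<open>Missing \<open>b\<close> on \<open>T\<close> is a pointwise constraint, so these
    functions again form a product and \<open>card_PiE\<close> counts them.\<close>
  have "{g \<in> A \<rightarrow>\<^sub>E B. b \<notin> g ` T} = (\<Pi>\<^sub>E x\<in>A. if x \<in> T then B - {b} else B)"
  proof (intro set_eqI iffI)
    fix g assume "g \<in> {g \<in> A \<rightarrow>\<^sub>E B. b \<notin> g ` T}"
    then show "g \<in> (\<Pi>\<^sub>E x\<in>A. if x \<in> T then B - {b} else B)"
      by (auto simp: PiE_iff)
  next
    fix g assume g: "g \<in> (\<Pi>\<^sub>E x\<in>A. if x \<in> T then B - {b} else B)"
    then have g': "g x \<in> (if x \<in> T then B - {b} else B)" if "x \<in> A" for x
      using that by (rule PiE_mem)
    have "g \<in> A \<rightarrow>\<^sub>E B"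
    proof (rule PiE_I)
      fix x assume "x \<in> A"
      then show "g x \<in> B" using g'[of x] by (simp split: if_splits)
    qed (rule PiE_arb[OF g])
    moreover have "b \<notin> g ` T"
      using g' assms(2) by force
    ultimately show "g \<in> {g \<in> A \<rightarrow>\<^sub>E B. b \<notin> g ` T}" by simp
  qed
  then have "card {g \<in> A \<rightarrow>\<^sub>E B. b \<notin> g ` T} = (\<Prod>x\<in>A. if x \<in> T then card (B - {b}) else card B)"
    using assms(1) by (simp add: card_PiE if_distrib[of card])
  also have "\<dots> = (card B - 1) ^ card T * card B ^ card (A - T)"
  proof -
    have "A \<inter> {x. x \<in> T} = T" "A \<inter> - {x. x \<in> T} = A - T" using assms(2) by auto
    then show ?thesis
      using assms(1) card_Diff_singleton[OF assms(4)] by (simp only: prod.If_cases prod_constant)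
  qed
  finally have eq: "real (card {g \<in> A \<rightarrow>\<^sub>E B. b \<notin> g ` T}) = (?M - 1) ^ card T * ?M ^ card (A - T)"
    using M by simp
  have "1 - 1 / ?M \<le> exp (- 1 / ?M)"
    using exp_ge_add_one_self[of "- 1 / ?M"] by simp
  moreover have "0 \<le> 1 - 1 / ?M" using M by (simp add: field_simps)
  ultimately have "(1 - 1 / ?M) ^ card T \<le> exp (- 1 / ?M) ^ card T"
    by (rule power_mono)
  also have "\<dots> = exp (- real (card T) / ?M)"
    by (simp flip: exp_of_nat_mult)
  finally have bound: "(1 - 1 / ?M) ^ card T * ?M ^ card A \<le> exp (- real (card T) / ?M) * ?M ^ card A"
    by (rule mult_right_mono) simp
  have "card A = card T + card (A - T)"
    using assms(1,2) by (metis card_Diff_subset card_mono finite_subset le_add_diff_inverse)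
  moreover have "1 - 1 / ?M = (?M - 1) / ?M"
    using M by (simp add: field_simps)
  ultimately have "(1 - 1 / ?M) ^ card T * ?M ^ card A = (?M - 1) ^ card T * ?M ^ card (A - T)"
    using M by (simp add: power_add power_divide)
  with bound show ?thesis
    using eq assms(1) by (simp add: card_funcsetE)
qed

text \<open>A uniformly random colouring works with positive probability, by the union bound.\<close>

lemma colouring_onto_each_set:
  assumes A: "finite A" and B: "finite B" "B \<noteq> {}"
    and I: "finite I" and T: "\<And>s. s \<in> I \<Longrightarrow> T s \<subseteq> A" "\<And>s. s \<in> I \<Longrightarrow> t \<le> real (card (T s))"
    and small: "real (card I) * real (card B) * exp (- t / real (card B)) < 1"
  shows "\<exists>g\<in>A \<rightarrow>\<^sub>E B. \<forall>s\<in>I. B \<subseteq> g ` T s"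
proof -
  let ?F = "A \<rightarrow>\<^sub>E B"
  \<comment> \<open>One bad event for each target set and colour: colour \<open>b\<close> does not
    occur on \<open>T s\<close>.\<close>
  let ?bad = "\<lambda>(s, b). {g \<in> ?F. b \<notin> g ` T s}"
  have F: "finite ?F" "card ?F > 0"
    using A B by (auto simp: finite_PiE card_funcsetE card_gt_0_iff)
  have "real (card (\<Union>p\<in>I \<times> B. ?bad p)) \<le> (\<Sum>p\<in>I \<times> B. real (card (?bad p)))"
    using card_UN_le[of "I \<times> B" ?bad] I B(1) by (simp flip: of_nat_sum)
  also have "\<dots> \<le> (\<Sum>p\<in>I \<times> B. exp (- t / real (card B)) * real (card ?F))"
  proof (rule sum_mono)
    fix p assume "p \<in> I \<times> B"
    then obtain s b where p: "p = (s, b)" "s \<in> I" "b \<in> B" by auto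
    have "exp (- real (card (T s)) / real (card B)) \<le> exp (- t / real (card B))"
      using T(2)[OF p(2)] by (simp add: divide_right_mono)
    then have "exp (- real (card (T s)) / real (card B)) * real (card ?F)
        \<le> exp (- t / real (card B)) * real (card ?F)"
      by (rule mult_right_mono) simp
    with card_functions_avoiding_value[OF A T(1)[OF p(2)] B(1) p(3)] p(1)
    show "real (card (?bad p)) \<le> exp (- t / real (card B)) * real (card ?F)" by simp
  qed
  also have "\<dots> = real (card I) * real (card B) * exp (- t / real (card B)) * real (card ?F)"
    by (simp add: card_cartesian_product)
  also have "\<dots> < real (card ?F)" using small F(2) by simp
  finally have "card (\<Union>p\<in>I \<times> B. ?bad p) < card ?F" by simp
  then have "\<not> ?F \<subseteq> (\<Union>p\<in>I \<times> B. ?bad p)"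
    using card_mono[of "\<Union>p\<in>I \<times> B. ?bad p" ?F] I B(1) F(1) by (auto simp: not_less)
  then obtain g where "g \<in> ?F" "g \<notin> (\<Union>p\<in>I \<times> B. ?bad p)" by blast
  then show ?thesis by (intro bexI[of _ g]) auto
qed

section \<open>The source distribution, and codes built from colourings\<close>

lemma set_source_pmf:
  "(m1, m2, s) \<in> set_pmf (source_pmf lam n R1 R2) \<Longrightarrow>
     m1 \<in> messages n R1 \<and> m2 \<in> messages n R2 \<and> length s = n"
  unfolding source_pmf_def by (auto simp: set_replicate_pmf)

lemma prob_source_state:
  "measure_pmf.prob (source_pmf lam n R1 R2) {(m1, m2, s). P s}
     = measure_pmf.prob (replicate_pmf n (bernoulli_pmf lam)) {s. P s}"
proof -
  have "map_pmf (snd \<circ> snd) (source_pmf lam n R1 R2) = replicate_pmf n (bernoulli_pmf lam)"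
    unfolding source_pmf_def by (simp add: map_snd_pair_pmf flip: pmf.map_comp)
  then have "measure_pmf.prob (replicate_pmf n (bernoulli_pmf lam)) {s. P s}
      = measure_pmf.prob (source_pmf lam n R1 R2) ((snd \<circ> snd) -` {s. P s})"
    by (metis measure_map_pmf)
  also have "(snd \<circ> snd) -` {s. P s} = {(m1 :: nat, m2 :: nat, s). P s}" by auto
  finally show ?thesis by simp
qed

text \<open>Events need only be compared on the support, where messages are in range and the state
  sequence has length \<open>n\<close>; codes are unconstrained elsewhere.\<close>

lemma prob_mono_on_support:
  assumes "\<And>x. x \<in> set_pmf p \<Longrightarrow> x \<in> A \<Longrightarrow> x \<in> B"
  shows "measure_pmf.prob p A \<le> measure_pmf.prob p B"
  by (rule measure_pmf.finite_measure_mono_AE) (use assms in \<open>auto simp: AE_measure_pmf_iff\<close>)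

text \<open>
  Encoder 1 sends \<open>0\<close> whenever \<open>S = 1\<close>, even when encoding fails, so that \<open>Y\<^sub>2 = X\<^sub>2\<close>
  always and the second user gets the full rate without error.
\<close>

lemma good_code_from_colouring:
  assumes q: "q \<ge> 1"
    and g: "g \<in> words q n \<rightarrow> messages n R1"
    and onto: "\<And>s. length s = n \<Longrightarrow> \<not> P s \<Longrightarrow> messages n R1 \<subseteq> g ` words_vanishing_on q s"
    and P: "measure_pmf.prob (replicate_pmf n (bernoulli_pmf lam)) {s. P s} \<le> \<epsilon>"
  shows "\<exists>f1 f2 g1 g2. good_code q lam n R1 (log 2 (real q)) \<epsilon> f1 (\<lambda>i m s. f2 i m)
            (\<lambda>y s. g1 y) (\<lambda>y s. g2 y)"
proof -
  let ?R2 = "log 2 (real q)"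
  define c where "c = (\<lambda>m s. SOME x. x \<in> words_vanishing_on q s \<and>
      (m \<in> g ` words_vanishing_on q s \<longrightarrow> g x = m))"
  have "c m s \<in> words_vanishing_on q s \<and> (m \<in> g ` words_vanishing_on q s \<longrightarrow> g (c m s) = m)" for m s
    unfolding c_def
  proof (rule someI_ex)
    \<comment> \<open>The zero word is compatible with every state sequence, so the choice exists
      even when no compatible word has colour \<open>m\<close>.\<close>
    have "replicate (length s) 0 \<in> words_vanishing_on q s"
      using q by (simp add: words_vanishing_on_iff)
    then show "\<exists>x. x \<in> words_vanishing_on q s \<and> (m \<in> g ` words_vanishing_on q s \<longrightarrow> g x = m)"
      by blast
  qed
  then have c: "\<And>m s. c m s \<in> words_vanishing_on q s"
      "\<And>m s. m \<in> g ` words_vanishing_on q s \<Longrightarrow> g (c m s) = m"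
    by simp_all
  \<comment> \<open>Both sets have q^n elements; \<open>e\<close> serves as the code of user 2 and
    its inverse as the decoder.\<close>
  obtain e where e: "bij_betw e (messages n ?R2) (words q n)"
    using finite_same_card_bij[OF finite_messages finite_words, of n ?R2 q n]
      card_messages_log[OF q, of n] card_words[of q n] by metis
  define f1 where "f1 = (\<lambda>i m s. c m s ! i)"
  define f2 where "f2 = (\<lambda>i m. e m ! i)"
  define g2 where "g2 = inv_into (messages n ?R2) e"
  have cE: "length (c m s) = n" "\<And>i. i < n \<Longrightarrow> c m s ! i < q"
      "\<And>i. i < n \<Longrightarrow> s ! i \<Longrightarrow> c m s ! i = 0" if "length s = n" for m s
    using c(1)[of m s] that by (auto simp: words_vanishing_on_iff)
  have eE: "length (e m) = n" "\<And>i. i < n \<Longrightarrow> e m ! i < q" if "m \<in> messages n ?R2" for m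
    using bij_betw_apply[OF e that] by (auto simp: words_iff)
  \<comment> \<open>Receiver 1 sees the chosen word itself, so the colouring \<open>g\<close>
    decodes it without knowing the state.\<close>
  have out1: "map fst (outputs q n f1 (\<lambda>i m s. f2 i m) m1 m2 s) = c m1 s"
    if "length s = n" for m1 m2 s
    using cE(1)[OF that, of m1]
    by (intro nth_equalityI) (auto simp: outputs_def channel_def f1_def)
  have out2: "map snd (outputs q n f1 (\<lambda>i m s. f2 i m) m1 m2 s) = e m2"
    if "length s = n" "m2 \<in> messages n ?R2" for m1 m2 s
  proof (rule nth_equalityI)
    show "length (map snd (outputs q n f1 (\<lambda>i m s. f2 i m) m1 m2 s)) = length (e m2)"
      using eE(1)[OF that(2)] by (simp add: outputs_def)
    fix i assume "i < length (map snd (outputs q n f1 (\<lambda>i m s. f2 i m) m1 m2 s))"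
    then have i: "i < n" by (simp add: outputs_def)
    have "e m2 ! i < q" by (rule eE(2)[OF that(2) i])
    moreover have "s ! i \<Longrightarrow> c m1 s ! i = 0" by (rule cE(3)[OF that(1) i])
    ultimately show "map snd (outputs q n f1 (\<lambda>i m s. f2 i m) m1 m2 s) ! i = e m2 ! i"
      using i by (simp add: outputs_def channel_def f1_def f2_def)
  qed
  have err1: "error1 q lam n R1 ?R2 f1 (\<lambda>i m s. f2 i m) (\<lambda>y s. g y) \<le> \<epsilon>"
  proof -
    have "error1 q lam n R1 ?R2 f1 (\<lambda>i m s. f2 i m) (\<lambda>y s. g y)
        \<le> measure_pmf.prob (source_pmf lam n R1 ?R2) {(m1, m2, s). P s}"
      unfolding error1_def
    proof (rule prob_mono_on_support)
      fix x assume x: "x \<in> set_pmf (source_pmf lam n R1 ?R2)"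
        "x \<in> {(m1, m2, s). g (map fst (outputs q n f1 (\<lambda>i m s. f2 i m) m1 m2 s)) \<noteq> m1}"
      obtain m1 m2 s where [simp]: "x = (m1, m2, s)" by (cases x)
      have m: "m1 \<in> messages n R1" "length s = n" using set_source_pmf x(1) by auto
      have "g (c m1 s) \<noteq> m1" using x(2) by (simp add: out1[OF m(2)])
      with c(2) have "m1 \<notin> g ` words_vanishing_on q s" by blast
      with onto[OF m(2)] m(1) show "x \<in> {(m1, m2, s). P s}" by auto
    qed
    with P show ?thesis by (simp add: prob_source_state)
  qed
  have err2: "error2 q lam n R1 ?R2 f1 (\<lambda>i m s. f2 i m) (\<lambda>y s. g2 y) \<le> \<epsilon>"
  proof -
    have "error2 q lam n R1 ?R2 f1 (\<lambda>i m s. f2 i m) (\<lambda>y s. g2 y)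
        \<le> measure_pmf.prob (source_pmf lam n R1 ?R2) {}"
      unfolding error2_def
    proof (rule prob_mono_on_support)
      fix x assume x: "x \<in> set_pmf (source_pmf lam n R1 ?R2)"
        "x \<in> {(m1, m2, s). g2 (map snd (outputs q n f1 (\<lambda>i m s. f2 i m) m1 m2 s)) \<noteq> m2}"
      obtain m1 m2 s where [simp]: "x = (m1, m2, s)" by (cases x)
      have m: "m2 \<in> messages n ?R2" "length s = n" using set_source_pmf x(1) by auto
      then have "g2 (e m2) = m2"
        unfolding g2_def using e by (simp add: bij_betw_def)
      with x(2) show "x \<in> {}" by (simp add: out2[OF m(2,1)])
    qed
    \<comment> \<open>The empty event has probability 0, and \<open>\<epsilon>\<close> is
      nonnegative because it bounds a probability.\<close>
    also have "\<dots> \<le> \<epsilon>" using order_trans[OF measure_nonneg P] by simp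
    finally show ?thesis .
  qed
  have "g2 y \<in> messages n ?R2" if "y \<in> words q n" for y
    unfolding g2_def using e that by (metis bij_betw_imp_surj_on inv_into_into)
  then have "good_code q lam n R1 ?R2 \<epsilon> f1 (\<lambda>i m s. f2 i m) (\<lambda>y s. g y) (\<lambda>y s. g2 y)"
    unfolding good_code_def encoder_on_def decoder_on_def
    using err1 err2 cE(2) eE(2) g by (auto simp: f1_def f2_def words_def Pi_iff)
  then show ?thesis by blast
qed

text \<open>The random colouring needs a rate strictly below the limit. The alternative
  \<open>R1 = 0\<close> covers the degenerate cases \<open>lam = 1\<close> and \<open>q = 1\<close>,
  where no such nonnegative rate exists.\<close>

lemma achievable_enc1_corner:
  assumes q: "q \<ge> 1" and lam: "0 \<le> lam" "lam \<le> 1"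
    and R1: "R1 = 0 \<or> 0 \<le> R1 \<and> R1 < (1 - lam) * log 2 (real q)"
  shows "achievable_enc1 q lam R1 (log 2 (real q))"
proof -
  let ?L = "log 2 (real q)"
  have L: "0 \<le> ?L" using q by simp
  have "\<forall>\<^sub>F n in sequentially. \<exists>f1 f2 g1 g2.
      good_code q lam n R1 ?L \<epsilon> f1 (\<lambda>i m s. f2 i m) (\<lambda>y s. g1 y) (\<lambda>y s. g2 y)"
    if eps: "\<epsilon> > 0" for \<epsilon>
  proof (cases "R1 = 0")
    case True
    have "\<exists>f1 f2 g1 g2. good_code q lam n R1 ?L \<epsilon> f1 (\<lambda>i m s. f2 i m) (\<lambda>y s. g1 y) (\<lambda>y s. g2 y)"
      for n
    \<comment> \<open>With a single message the constant colouring succeeds for every state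
      sequence, so no exceptional event is required.\<close>
    proof (rule good_code_from_colouring[OF q, where g = "\<lambda>_. 1" and P = "\<lambda>_. False"])
      fix s :: "bool list"
      have "replicate (length s) 0 \<in> words_vanishing_on q s"
        using q by (simp add: words_vanishing_on_iff)
      then show "messages n R1 \<subseteq> (\<lambda>_. 1) ` words_vanishing_on q s"
        by (auto simp: True messages_zero)
    qed (use eps in \<open>auto simp: True messages_zero\<close>)
    then show ?thesis by simp
  next
    case False
    with R1 have R: "0 \<le> R1" "R1 < (1 - lam) * ?L" by auto
    then have Lpos: "0 < ?L" using L lam by (cases "?L = 0") auto
    \<comment> \<open>Half of the rate gap is spent on the deviation \<open>\<delta>\<close> of the
      weight. The other half, \<open>c\<close>, remains as the exponent by which compatible words
      outnumber messages.\<close>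
    define c where "c = ((1 - lam) * ?L - R1) / 2"
    define \<delta> where "\<delta> = c / ?L"
    have c: "c > 0" "(1 - lam - \<delta>) * ?L = R1 + c"
      using R Lpos by (auto simp: c_def \<delta>_def field_simps)
    have \<delta>: "\<delta> > 0" using c Lpos by (simp add: \<delta>_def)
    let ?P = "\<lambda>n s. real n * (lam + \<delta>) \<le> real (weight s)"
    \<comment> \<open>The union bound over at most 2^n state sequences and 2 * 2^(n R1) colours:
      each failure probability is at most exp(-2^(n c) / 2), whose doubly exponential decay
      wins.\<close>
    have "(\<lambda>n. 2 powr (real n * (1 + R1)) * 2 * exp (- (2 powr (real n * c)) / 2)) \<longlonglongrightarrow> 0"
      using R(1) c(1) by real_asymp
    then have "\<forall>\<^sub>F n in sequentially.
        2 powr (real n * (1 + R1)) * 2 * exp (- (2 powr (real n * c)) / 2) < 1"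
      by (rule order_tendstoD) simp
    moreover have "\<forall>\<^sub>F n in sequentially.
        measure_pmf.prob (replicate_pmf n (bernoulli_pmf lam)) {s. ?P n s} < \<epsilon>"
      using weight_upper_tail[OF lam \<delta>] eps by (rule order_tendstoD)
    ultimately show ?thesis
    proof eventually_elim
      case (elim n)
      let ?B = "messages n R1"
      \<comment> \<open>Only typical state sequences must see all colours; the others are charged to
        the error probability.\<close>
      let ?I = "{s :: bool list. length s = n \<and> \<not> ?P n s}"
      let ?t = "2 powr (real n * (R1 + c))"
      have fin: "finite {s :: bool list. length s = n}" "card {s :: bool list. length s = n} = 2 ^ n"
        using finite_lists_length_eq[of "UNIV :: bool set" n]
          card_lists_length_eq[of "UNIV :: bool set" n] by simp_all
      have I: "finite ?I" "card ?I \<le> 2 ^ n"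
        using fin card_mono[OF fin(1), of ?I] by (auto intro: finite_subset[OF _ fin(1)])
      have size: "?t \<le> real (card (words_vanishing_on q s))" if "s \<in> ?I" for s
      proof -
        have "weight s \<le> n" using that length_filter_le[of "\<lambda>b. b" s] by simp
        then have "real n * (1 - lam - \<delta>) \<le> real (n - weight s)"
          using that by (simp add: algebra_simps)
        then have "real n * (1 - lam - \<delta>) * ?L \<le> real (n - weight s) * ?L"
          using L by (rule mult_right_mono)
        then have "real n * (R1 + c) \<le> real (n - weight s) * ?L"
          using c(2) by (simp add: mult.assoc)
        then show ?thesis
          using that by (simp add: card_words_vanishing_on[OF q] powr_log_eq_power[OF q])
      qed
      have small: "real (card ?I) * real (card ?B) * exp (- ?t / real (card ?B)) < 1"
      proof -
        have B: "real (card ?B) \<le> 2 * 2 powr (real n * R1)" "0 < real (card ?B)"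
          using card_messages_le[OF R(1)] card_messages_pos by auto
        have "?t = 2 powr (real n * c) / 2 * (2 * 2 powr (real n * R1))"
          by (simp add: distrib_left powr_add)
        also have "\<dots> \<ge> 2 powr (real n * c) / 2 * real (card ?B)"
          using B(1) by (intro mult_left_mono) auto
        finally have "2 powr (real n * c) / 2 \<le> ?t / real (card ?B)"
          using B(2) by (simp add: field_simps)
        then have "exp (- ?t / real (card ?B)) \<le> exp (- (2 powr (real n * c)) / 2)" by simp
        moreover have prefactor: "real (card ?I) * real (card ?B) \<le> 2 powr real n * (2 * 2 powr (real n * R1))"
        proof (rule mult_mono)
          have "real (card ?I) \<le> real (2 ^ n)" using I(2) by (rule of_nat_mono)
          then show "real (card ?I) \<le> 2 powr real n" by (simp add: powr_realpow)
        qed (use B in simp_all)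
        ultimately have "real (card ?I) * real (card ?B) * exp (- ?t / real (card ?B))
            \<le> 2 powr real n * (2 * 2 powr (real n * R1)) * exp (- (2 powr (real n * c)) / 2)"
          by (intro mult_mono[OF prefactor]) simp_all
        also have "2 powr real n * (2 * 2 powr (real n * R1)) = 2 powr (real n * (1 + R1)) * 2"
          by (simp add: algebra_simps powr_add)
        finally show ?thesis using elim(1) by linarith
      qed
      have sub: "words_vanishing_on q s \<subseteq> words q n" if "s \<in> ?I" for s
        using that by (intro words_vanishing_on_subset) simp
      obtain g where g: "g \<in> words q n \<rightarrow>\<^sub>E ?B"
          "\<forall>s\<in>?I. ?B \<subseteq> g ` words_vanishing_on q s"
        using colouring_onto_each_set[OF finite_words finite_messages messages_nonempty I(1) sub
            size small] by (rule bexE)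
      show ?case
      proof (rule good_code_from_colouring[OF q])
        show "g \<in> words q n \<rightarrow> ?B" using g(1) by auto
        show "?B \<subseteq> g ` words_vanishing_on q s" if "length s = n" "\<not> ?P n s" for s
          using that by (intro g(2)[rule_format]) simp
        show "measure_pmf.prob (replicate_pmf n (bernoulli_pmf lam)) {s. ?P n s} \<le> \<epsilon>"
          using elim(2) by simp
      qed
    qed
  qed
  then show ?thesis
    unfolding achievable_enc1_def using R1 L by auto
qed

lemma corner_in_capacity_region_enc1:
  assumes q: "q \<ge> 1" and lam: "0 \<le> lam" "lam \<le> 1"
  shows "((1 - lam) * log 2 (real q), log 2 (real q)) \<in> capacity_region_enc1 q lam"
proof -
  let ?L = "log 2 (real q)"
  \<comment> \<open>These rates approach the corner from below, or are constantly 0 when the limit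
    is 0; the closure then supplies the corner.\<close>
  let ?r = "\<lambda>k. (1 - lam) * ?L * (1 - 1 / real (Suc k))"
  have L: "0 \<le> ?L" using q by simp
  have "achievable_enc1 q lam (?r k) ?L" for k
  proof (rule achievable_enc1_corner[OF q lam])
    show "?r k = 0 \<or> 0 \<le> ?r k \<and> ?r k < (1 - lam) * ?L"
    proof (cases "(1 - lam) * ?L = 0")
      case False
      moreover have "0 \<le> (1 - lam) * ?L" using L lam by (intro mult_nonneg_nonneg) auto
      ultimately have pos: "0 < (1 - lam) * ?L" by linarith
      have "0 \<le> 1 - 1 / real (Suc k)" "1 - 1 / real (Suc k) < 1" by (auto simp: field_simps)
      then have "0 \<le> ?r k" "?r k < (1 - lam) * ?L * 1"
        using pos by (intro mult_nonneg_nonneg[OF less_imp_le] mult_strict_left_mono; simp)+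
      then show ?thesis by simp
    qed simp
  qed
  moreover have "(\<lambda>k. (?r k, ?L)) \<longlonglongrightarrow> ((1 - lam) * ?L * (1 - 0), ?L)"
    by (intro tendsto_intros LIMSEQ_Suc[OF lim_1_over_n])
  ultimately show ?thesis
    unfolding capacity_region_enc1_def closure_sequential
    by (intro exI[of _ "\<lambda>k. (?r k, ?L)"]) auto
qed

section \<open>Converse\<close>

text \<open>Once the state sequence is fixed the channel is deterministic, so correct decoding
  becomes a matter of counting pairs.\<close>

definition correct_pairs ::
  "nat \<Rightarrow> nat \<Rightarrow> real \<Rightarrow> real \<Rightarrow> encoder \<Rightarrow> encoder \<Rightarrow> decoder \<Rightarrow> decoder \<Rightarrow> bool list \<Rightarrow> (nat \<times> nat) set"
  where "correct_pairs q n R1 R2 f1 f2 g1 g2 s =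
    {(m1, m2). m1 \<in> messages n R1 \<and> m2 \<in> messages n R2 \<and>
       g1 (map fst (outputs q n f1 f2 m1 m2 s)) s = m1 \<and>
       g2 (map snd (outputs q n f1 f2 m1 m2 s)) s = m2}"

text \<open>This inverts the channel at a time with \<open>S = 1\<close>: the second input and
  output determine the first input.\<close>

lemma mod_add_left_cancel:
  fixes a b c q :: nat
  assumes "(c + a) mod q = (c + b) mod q" "a < q" "b < q"
  shows "a = b"
proof -
  have *: "x = y"
    if "x \<le> y" "(c + x) mod q = (c + y) mod q" "x < q" "y < q" for x y :: nat
  proof -
    have "q dvd (c + y) - (c + x)"
      using mod_eq_dvd_iff_nat[of "c + x" "c + y" q] that(1) that(2)[symmetric] by linarith
    then have "q dvd y - x" by simp
    moreover have "y - x < q" using that(4) by linarith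
    ultimately have "\<not> 0 < y - x" using nat_dvd_not_less by blast
    with that(1) show ?thesis by linarith
  qed
  show ?thesis
    using *[OF _ assms] *[OF _ assms(1)[symmetric] assms(3,2)] by linarith
qed

text \<open>
  Given \<open>s\<close>, the word \<open>Y\<^sub>2\<close> reveals \<open>m\<^sub>2\<close>, hence \<open>X\<^sub>2\<close>, hence \<open>X\<^sub>1\<close> at the positions with \<open>S = 1\<close>;
  together with \<open>X\<^sub>1\<close> at the remaining positions this is all of \<open>Y\<^sub>1\<close>.
\<close>

lemma card_correct_pairs_le:
  assumes q: "q \<ge> 1" and s: "length s = n"
    and enc: "encoder_on q n R1 f1" "encoder_on q n R2 f2"
  shows "card (correct_pairs q n R1 R2 f1 f2 g1 g2 s) \<le> q ^ n * q ^ (n - weight s)"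
proof -
  let ?D = "correct_pairs q n R1 R2 f1 f2 g1 g2 s"
  let ?y1 = "\<lambda>(m1, m2). map fst (outputs q n f1 f2 m1 m2 s)"
  let ?y2 = "\<lambda>(m1, m2). map snd (outputs q n f1 f2 m1 m2 s)"
  \<comment> \<open>Positions with state 1 are blanked with 0, which places \<open>?z\<close> in
    \<open>words_vanishing_on q s\<close> and reuses its cardinality.\<close>
  let ?z = "\<lambda>(m1, m2 :: nat). map (\<lambda>i. if s ! i then 0 else f1 i m1 s) [0..<n]"
  have f1: "f1 i m s < q" if "i < n" "m \<in> messages n R1" for i m
    using enc(1) s that by (auto simp: encoder_on_def)
  have "inj_on (\<lambda>p. (?y2 p, ?z p)) ?D"
  proof (rule inj_onI)
    fix p p' assume p: "p \<in> ?D" "p' \<in> ?D" and eq: "(?y2 p, ?z p) = (?y2 p', ?z p')"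
    obtain m1 m2 m1' m2' where pp: "p = (m1, m2)" "p' = (m1', m2')" by (cases p, cases p')
    have m: "m1 \<in> messages n R1" "m1' \<in> messages n R1"
      and dec1: "m1 = g1 (?y1 (m1, m2)) s" "m1' = g1 (?y1 (m1', m2')) s"
      and dec2: "m2 = g2 (?y2 (m1, m2)) s" "m2' = g2 (?y2 (m1', m2')) s"
      using p by (simp_all add: pp correct_pairs_def)
    have y2: "?y2 (m1, m2) = ?y2 (m1', m2')"
      using arg_cong[OF eq, of fst] by (simp only: pp fst_conv)
    have z: "?z (m1, m2) = ?z (m1', m2')"
      using arg_cong[OF eq, of snd] by (simp only: pp snd_conv)
    have m2: "m2 = m2'" by (rule trans[OF dec2(1) trans[OF _ dec2(2)[symmetric]]]) (simp only: y2)
    have "f1 i m1 s = f1 i m1' s" if i: "i < n" for i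
    proof (cases "s ! i")
      case True
      have "?y2 (m1, m2) ! i = ?y2 (m1', m2') ! i" by (simp only: y2)
      then have "(f2 i m2' s + f1 i m1 s) mod q = (f2 i m2' s + f1 i m1' s) mod q"
        using i True unfolding m2 by (simp add: outputs_def channel_def)
      then show ?thesis
        by (rule mod_add_left_cancel[OF _ f1[OF i m(1)] f1[OF i m(2)]])
    next
      case False
      have "?z (m1, m2) ! i = ?z (m1', m2') ! i" by (simp only: z)
      then show ?thesis using i False by simp
    qed
    then have y1: "?y1 (m1, m2) = ?y1 (m1', m2')" by (simp add: outputs_def channel_def)
    have "m1 = m1'" by (rule trans[OF dec1(1) trans[OF _ dec1(2)[symmetric]]]) (simp only: y1)
    with m2 show "p = p'" unfolding pp by simp
  qed
  moreover have "(\<lambda>p. (?y2 p, ?z p)) ` ?D \<subseteq> words q n \<times> words_vanishing_on q s"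
  proof (rule image_subsetI)
    fix p assume "p \<in> ?D"
    then obtain m1 m2 where pp: "p = (m1, m2)" and m1: "m1 \<in> messages n R1"
      by (auto simp: correct_pairs_def)
    have "?y2 (m1, m2) \<in> words q n"
      using q by (simp add: words_iff outputs_def channel_def)
    moreover have "?z (m1, m2) \<in> words_vanishing_on q s"
      using q f1[OF _ m1] by (simp add: words_vanishing_on_iff s)
    ultimately show "(?y2 p, ?z p) \<in> words q n \<times> words_vanishing_on q s"
      unfolding pp by (rule SigmaI)
  qed
  moreover have "finite (words q n \<times> words_vanishing_on q s)"
    by (intro finite_cartesian_product finite_words
        finite_subset[OF words_vanishing_on_subset[OF s]])
  ultimately have "card ?D \<le> card (words q n \<times> words_vanishing_on q s)"
    by (rule card_inj_on_le)
  then show ?thesis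
    using s by (simp add: card_cartesian_product card_words card_words_vanishing_on[OF q])
qed

text \<open>Messages are uniform and independent of the state, so given \<open>s\<close> the pairs
  in \<open>D s\<close> have probability |D s| divided by the number of message pairs. Averaging
  over \<open>G\<close> preserves the bound.\<close>

lemma prob_source_le:
  assumes "\<And>s. s \<in> G \<Longrightarrow> D s \<subseteq> messages n R1 \<times> messages n R2"
    and "\<And>s. s \<in> G \<Longrightarrow> real (card (D s)) \<le> N" and G: "finite G" and N: "0 \<le> N"
  shows "measure_pmf.prob (source_pmf lam n R1 R2) {(m1, m2, s). s \<in> G \<and> (m1, m2) \<in> D s}
           \<le> N / (real (card (messages n R1)) * real (card (messages n R2)))"
proof -
  let ?M = "real (card (messages n R1)) * real (card (messages n R2))"
  let ?C = "replicate_pmf n (bernoulli_pmf lam)"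
  let ?h = "\<lambda>(s, m1, m2). (m1, m2, s)"
  have fin: "finite (D s)" if "s \<in> G" for s
    using assms(1)[OF that] by (rule finite_subset) simp
  have "{(m1, m2, s). s \<in> G \<and> (m1, m2) \<in> D s} = ?h ` Sigma G D" (is "?A = _")
  proof (intro set_eqI iffI)
    fix x assume "x \<in> ?A"
    then obtain m1 m2 s where "x = (m1, m2, s)" "s \<in> G" "(m1, m2) \<in> D s" by auto
    then show "x \<in> ?h ` Sigma G D" by (intro image_eqI[of _ _ "(s, m1, m2)"]) auto
  qed auto
  then have "measure_pmf.prob (source_pmf lam n R1 R2) {(m1, m2, s). s \<in> G \<and> (m1, m2) \<in> D s}
      = (\<Sum>x\<in>?h ` Sigma G D. pmf (source_pmf lam n R1 R2) x)"
    using G fin by (simp add: measure_measure_pmf_finite)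
  also have "\<dots> = (\<Sum>x\<in>Sigma G D. pmf (source_pmf lam n R1 R2) (?h x))"
    by (subst sum.reindex) (auto simp: inj_on_def)
  also have "\<dots> = (\<Sum>(s, p)\<in>Sigma G D. pmf ?C s / ?M)"
  proof (intro sum.cong refl)
    fix x assume "x \<in> Sigma G D"
    then obtain s m1 m2 where x: "x = (s, m1, m2)" "s \<in> G" "(m1, m2) \<in> D s" by auto
    then have "m1 \<in> messages n R1" "m2 \<in> messages n R2" using assms(1) by auto
    with x(1) show "pmf (source_pmf lam n R1 R2) (?h x) = (case x of (s, p) \<Rightarrow> pmf ?C s / ?M)"
      by (simp add: source_pmf_def pmf_pair)
  qed
  also have "\<dots> = (\<Sum>s\<in>G. \<Sum>p\<in>D s. pmf ?C s / ?M)"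
    using G fin by (subst sum.Sigma) auto
  also have "\<dots> = (\<Sum>s\<in>G. pmf ?C s * (real (card (D s)) / ?M))"
    by (simp add: mult.commute)
  also have "\<dots> \<le> (\<Sum>s\<in>G. pmf ?C s * (N / ?M))"
    using assms(2) by (intro sum_mono mult_left_mono divide_right_mono) auto
  also have "\<dots> = measure_pmf.prob ?C G * (N / ?M)"
    by (subst measure_measure_pmf_finite[OF G]) (rule sum_distrib_right[symmetric])
  also have "\<dots> \<le> 1 * (N / ?M)"
    using N by (intro mult_right_mono) auto
  finally show ?thesis by simp
qed

text \<open>A bound for each single \<open>n\<close>: either a decoder errs, or the weight is at
  most \<open>n * a\<close>, or the pair is among the few that can be correct. The threshold
  \<open>a\<close> stays free, to be set just below \<open>lam\<close>.\<close>

lemma good_code_bound: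
  assumes q: "q \<ge> 1"
    and code: "good_code q lam n R1 R2 \<epsilon> f1 f2 g1 g2"
  shows "1 - 2 * \<epsilon> \<le> measure_pmf.prob (replicate_pmf n (bernoulli_pmf lam))
              {s. real (weight s) \<le> real n * a}
           + 2 powr (real n * ((2 - a) * log 2 (real q) - (R1 + R2)))"
proof -
  let ?L = "log 2 (real q)"
  let ?S = "source_pmf lam n R1 R2"
  let ?E1 = "{(m1, m2, s). g1 (map fst (outputs q n f1 f2 m1 m2 s)) s \<noteq> m1}"
  let ?E2 = "{(m1, m2, s). g2 (map snd (outputs q n f1 f2 m1 m2 s)) s \<noteq> m2}"
  let ?W = "{(m1 :: nat, m2 :: nat, s). real (weight s) \<le> real n * a}"
  let ?G = "{s. length s = n \<and> \<not> real (weight s) \<le> real n * a}"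
  let ?D = "correct_pairs q n R1 R2 f1 f2 g1 g2"
  let ?X = "{(m1, m2, s). s \<in> ?G \<and> (m1, m2) \<in> ?D s}"
  let ?N = "2 powr (real n * ((2 - a) * ?L))"
  let ?M = "real (card (messages n R1)) * real (card (messages n R2))"
  have L: "0 \<le> ?L" using q by simp
  have E: "measure_pmf.prob ?S ?E1 \<le> \<epsilon>" "measure_pmf.prob ?S ?E2 \<le> \<epsilon>"
    and enc: "encoder_on q n R1 f1" "encoder_on q n R2 f2"
    using code by (auto simp: good_code_def error1_def error2_def)
  have "1 = measure_pmf.prob ?S UNIV" by simp
  also have "\<dots> \<le> measure_pmf.prob ?S (?E1 \<union> (?E2 \<union> (?W \<union> ?X)))"
    by (rule prob_mono_on_support) (auto simp: correct_pairs_def dest!: set_source_pmf)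
  also have "\<dots> \<le> measure_pmf.prob ?S ?E1 + (measure_pmf.prob ?S ?E2 +
      (measure_pmf.prob ?S ?W + measure_pmf.prob ?S ?X))"
    using measure_Un_le[of ?E1 ?S "?E2 \<union> (?W \<union> ?X)"] measure_Un_le[of ?E2 ?S "?W \<union> ?X"]
      measure_Un_le[of ?W ?S ?X] by simp
  also have "measure_pmf.prob ?S ?X \<le> ?N / ?M"
  proof (rule prob_source_le)
    show "finite ?G"
      using finite_lists_length_eq[of "UNIV :: bool set" n] by (auto intro: rev_finite_subset)
    fix s assume s: "s \<in> ?G"
    show "?D s \<subseteq> messages n R1 \<times> messages n R2" by (auto simp: correct_pairs_def)
    have "weight s \<le> n" using s length_filter_le[of "\<lambda>b. b" s] by simp
    then have "real (n + (n - weight s)) \<le> real n * (2 - a)"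
      using s by (simp add: algebra_simps)
    then have "real (n + (n - weight s)) * ?L \<le> real n * (2 - a) * ?L"
      using L by (rule mult_right_mono)
    then have "real q ^ (n + (n - weight s)) \<le> ?N"
      by (simp only: powr_log_eq_power[OF q]) (simp add: mult.assoc)
    moreover have "card (?D s) \<le> q ^ (n + (n - weight s))"
      using card_correct_pairs_le[OF q _ enc] s by (simp add: power_add)
    then have "real (card (?D s)) \<le> real q ^ (n + (n - weight s))"
      by (metis of_nat_mono of_nat_power)
    ultimately show "real (card (?D s)) \<le> ?N" by linarith
  qed simp
  \<comment> \<open>Rounding the message counts up only helps here, so no constant factor
    appears.\<close>
  also have "?N / ?M \<le> ?N / (2 powr (real n * R1) * 2 powr (real n * R2))"
    by (intro divide_left_mono mult_mono card_messages_ge mult_pos_pos)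
       (auto simp: card_messages_pos card_gt_0_iff)
  also have "\<dots> = 2 powr (real n * ((2 - a) * ?L - (R1 + R2)))"
    by (simp add: right_diff_distrib distrib_left powr_add powr_diff)
  also have "measure_pmf.prob ?S ?W = measure_pmf.prob (replicate_pmf n (bernoulli_pmf lam))
      {s. real (weight s) \<le> real n * a}"
    by (rule prob_source_state)
  finally show ?thesis using E by linarith
qed

lemma achievable_all_sum_le:
  assumes q: "q \<ge> 1" and lam: "0 \<le> lam" "lam \<le> 1" and ach: "achievable_all q lam R1 R2"
  shows "R1 + R2 \<le> (2 - lam) * log 2 (real q)"
proof (rule ccontr)
  let ?L = "log 2 (real q)"
  define c where "c = (R1 + R2 - (2 - lam) * ?L) / 2"
  \<comment> \<open>The summand 1 avoids division by 0 when \<open>q = 1\<close>; all that is used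
    is \<open>\<delta> > 0\<close> and \<open>\<delta> * ?L \<le> c\<close>, which leaves an
    exponent of at most \<open>- c\<close>.\<close>
  define \<delta> where "\<delta> = c / (?L + 1)"
  assume "\<not> R1 + R2 \<le> (2 - lam) * ?L"
  then have c: "c > 0" by (simp add: c_def)
  have L: "0 \<le> ?L" using q by simp
  with c have \<delta>: "\<delta> > 0" by (simp add: \<delta>_def)
  have "\<delta> * ?L \<le> c" using c L by (simp add: \<delta>_def field_simps)
  moreover have "(2 - (lam - \<delta>)) * ?L - (R1 + R2) = \<delta> * ?L - 2 * c"
    unfolding c_def by (simp add: field_simps)
  ultimately have exponent: "(2 - (lam - \<delta>)) * ?L - (R1 + R2) \<le> - c" by linarith
  have "(\<lambda>n. 2 powr (real n * - c)) \<longlonglongrightarrow> 0"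
    using c by real_asymp
  then have "\<forall>\<^sub>F n in sequentially. 2 powr (real n * - c) < 1 / 4"
    by (rule order_tendstoD) simp
  moreover have "\<forall>\<^sub>F n in sequentially. measure_pmf.prob (replicate_pmf n (bernoulli_pmf lam))
      {s. real (weight s) \<le> real n * (lam - \<delta>)} < 1 / 4"
    using weight_lower_tail[OF lam \<delta>] by (rule order_tendstoD) simp
  \<comment> \<open>With error 1/4 at each receiver the left side of \<open>good_code_bound\<close>
    is 1/2, whereas both terms on the right are eventually below 1/4.\<close>
  moreover have "\<forall>\<^sub>F n in sequentially. \<exists>f1 f2 g1 g2. good_code q lam n R1 R2 (1 / 4) f1 f2 g1 g2"
    using ach by (simp add: achievable_all_def)
  ultimately have "\<forall>\<^sub>F n :: nat in sequentially. False"
  proof eventually_elim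
    case (elim n)
    then obtain f1 f2 g1 g2 where "good_code q lam n R1 R2 (1 / 4) f1 f2 g1 g2" by blast
    from good_code_bound[OF q this, of "lam - \<delta>"] elim(2)
    have "1 / 4 < 2 powr (real n * ((2 - (lam - \<delta>)) * ?L - (R1 + R2)))" by simp
    also have "\<dots> \<le> 2 powr (real n * - c)"
      using exponent by (intro powr_mono mult_left_mono) auto
    finally show False using elim(1) by simp
  qed
  then show False by simp
qed

section \<open>Passing to the closures, and the sum-capacity\<close>

lemma capacity_region_all_sum_le:
  assumes "q \<ge> 1" "0 \<le> lam" "lam \<le> 1" "(R1, R2) \<in> capacity_region_all q lam"
  shows "R1 + R2 \<le> (2 - lam) * log 2 (real q)"
proof -
  let ?H = "{p :: real \<times> real. fst p + snd p \<le> (2 - lam) * log 2 (real q)}"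
  have "closed ?H" by (intro closed_Collect_le continuous_intros)
  moreover have "{(R1, R2). achievable_all q lam R1 R2} \<subseteq> ?H"
    using achievable_all_sum_le[OF assms(1-3)] by auto
  ultimately have "capacity_region_all q lam \<subseteq> ?H"
    unfolding capacity_region_all_def by (rule closure_minimal[rotated])
  with assms(4) show ?thesis by auto
qed

text \<open>Ignoring the state is a special case of reading it. Hence one corner point of the
  smaller region and one upper bound on the larger region settle both sum-capacities.\<close>

lemma capacity_region_enc1_subset_all: "capacity_region_enc1 q lam \<subseteq> capacity_region_all q lam"
proof -
  have "achievable_all q lam R1 R2" if "achievable_enc1 q lam R1 R2" for R1 R2
    using that unfolding achievable_all_def achievable_enc1_def by (fast elim: eventually_mono)
  then show ?thesis
    unfolding capacity_region_all_def capacity_region_enc1_def by (intro closure_mono) auto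
qed

lemma is_sum_capacity_unique:
  assumes "is_sum_capacity C c" "is_sum_capacity C c'"
  shows "c = c'"
proof (rule antisym)
  show "c \<le> c'" using assms unfolding is_sum_capacity_def by auto
  show "c' \<le> c" using assms unfolding is_sum_capacity_def by auto
qed

theorem mainTheorem5:
  fixes q :: nat and lam :: real
  assumes "q \<ge> 1" and "0 \<le> lam" and "lam \<le> 1"
  shows "is_sum_capacity (capacity_region_enc1 q lam) ((2 - lam) * log 2 (real q))
    \<and> is_sum_capacity (capacity_region_all q lam) ((2 - lam) * log 2 (real q))
    \<and> (\<forall>c. is_sum_capacity (capacity_region_all q lam) c
           \<longleftrightarrow> is_sum_capacity (capacity_region_enc1 q lam) c)"
proof -
  let ?c = "(2 - lam) * log 2 (real q)"
  have sum: "(1 - lam) * log 2 (real q) + log 2 (real q) = ?c" by (simp add: algebra_simps)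
  note corner = corner_in_capacity_region_enc1[OF assms]
  note sub = capacity_region_enc1_subset_all[of q lam]
  note le = capacity_region_all_sum_le[OF assms]
  have "is_sum_capacity (capacity_region_enc1 q lam) ?c"
    unfolding is_sum_capacity_def
  proof
    show "\<exists>(R1, R2)\<in>capacity_region_enc1 q lam. R1 + R2 = ?c"
      by (rule bexI[OF _ corner]) (simp only: prod.case sum)
    show "\<forall>(R1, R2)\<in>capacity_region_enc1 q lam. R1 + R2 \<le> ?c"
      using le sub by auto
  qed
  moreover have "is_sum_capacity (capacity_region_all q lam) ?c"
    unfolding is_sum_capacity_def
  proof
    show "\<exists>(R1, R2)\<in>capacity_region_all q lam. R1 + R2 = ?c"
      by (rule bexI[OF _ subsetD[OF sub corner]]) (simp only: prod.case sum)
    show "\<forall>(R1, R2)\<in>capacity_region_all q lam. R1 + R2 \<le> ?c"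
      using le by auto
  qed
  \<comment> \<open>By uniqueness, being the sum-capacity of either region means being equal to
    \<open>?c\<close>, which gives the equivalence.\<close>
  ultimately show ?thesis by (metis is_sum_capacity_unique)
qed

end
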